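(* Let $Z$ be a closed subspace of $C[0,1]$ that contains no subspace isomorphic to $\ell^1$. Then $C[0,1]/Z$ has the slice diameter two property.
   Context: $C[0,1]$ is the real Banach space of continuous functions on $[0,1]$ with the supremum norm; quotients carry the quotient norm; "isomorphic" means linearly homeomorphic. For a normed space $X$ with closed unit ball $B_X$, a slice of $B_X$ is a set of the form $\{x \in B_X \mid x^*(x) > 1 - \varepsilon\}$ with $x^* \in S_{X^*}$ (the unit sphere of $X^*$) and $\varepsilon > 0$. $X$ has the slice diameter two property if every slice of $B_X$ has diameter $2$. *)

theory Defs
  imports "HOL-Analysis.Analysis"
begin

section \<open>The Banach space \<open>C[0,1]\<close>\<close>

typedef unit_interval = "{0..1::real}"
  by (rule exI[of _ 0]) simp

instantiation unit_interval :: metric_space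
begin

definition dist_unit_interval :: "unit_interval \<Rightarrow> unit_interval \<Rightarrow> real" where
  "dist_unit_interval x y = dist (Rep_unit_interval x) (Rep_unit_interval y)"

definition uniformity_unit_interval :: "(unit_interval \<times> unit_interval) filter" where
  "uniformity_unit_interval = (INF e\<in>{0<..}. principal {(x, y). dist x y < e})"

definition open_unit_interval :: "unit_interval set \<Rightarrow> bool" where
  "open_unit_interval U =
     (\<forall>x\<in>U. eventually (\<lambda>(x', y). x' = x \<longrightarrow> y \<in> U) uniformity)"

instance
proof
  show "dist x y = 0 \<longleftrightarrow> x = y" for x y :: unit_interval
    by (simp add: dist_unit_interval_def Rep_unit_interval_inject)
  show "dist x y \<le> dist x z + dist y z" for x y z :: unit_interval
    unfolding dist_unit_interval_def by (rule dist_triangle2)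
qed (simp_all add: uniformity_unit_interval_def open_unit_interval_def)

end

text \<open>Type \<open>bcontfun\<close> consists of the bounded continuous functions, with the supremum norm.
  The domain is compact, so it contains every continuous function (\<open>bcontfun_unit_interval\<close>).\<close>

type_synonym C01 = "unit_interval \<Rightarrow>\<^sub>C real"

lemma compact_UNIV_unit_interval: "compact (UNIV :: unit_interval set)"
proof -
  have "continuous_on {0..1} Abs_unit_interval"
    unfolding continuous_on_iff
    by (auto simp: dist_unit_interval_def Abs_unit_interval_inverse)
  moreover have "(UNIV :: unit_interval set) = Abs_unit_interval ` {0..1}"
    by (metis Rep_unit_interval Rep_unit_interval_inverse UNIV_eq_I image_eqI)
  ultimately show ?thesis
    by (metis compact_Icc compact_continuous_image)
qed

lemma bcontfun_unit_interval:
  fixes f :: "unit_interval \<Rightarrow> real"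
  shows "f \<in> bcontfun \<longleftrightarrow> continuous_on UNIV f"
  using compact_continuous_image[OF _ compact_UNIV_unit_interval]
  by (auto simp: bcontfun_def intro: compact_imp_bounded)


section \<open>Real normed spaces with explicit carrier\<close>

text \<open>The quotient \<open>C[0,1]/Z\<close> depends on the set \<open>Z\<close>, so it cannot be an instance of the class
  \<open>real_normed_vector\<close>.\<close>

record 'a nspace =
  ncarrier :: "'a set"
  nadd :: "'a \<Rightarrow> 'a \<Rightarrow> 'a"
  nzero :: "'a"
  nscale :: "real \<Rightarrow> 'a \<Rightarrow> 'a"
  nnorm :: "'a \<Rightarrow> real"

locale normed_space_on =
  fixes X :: "'a nspace"
  assumes add_closed: "\<And>x y. \<lbrakk>x \<in> ncarrier X; y \<in> ncarrier X\<rbrakk> \<Longrightarrow> nadd X x y \<in> ncarrier X"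
    and zero_closed: "nzero X \<in> ncarrier X"
    and scale_closed: "\<And>c x. x \<in> ncarrier X \<Longrightarrow> nscale X c x \<in> ncarrier X"
    and add_assoc: "\<And>x y z. \<lbrakk>x \<in> ncarrier X; y \<in> ncarrier X; z \<in> ncarrier X\<rbrakk>
          \<Longrightarrow> nadd X (nadd X x y) z = nadd X x (nadd X y z)"
    and add_commute: "\<And>x y. \<lbrakk>x \<in> ncarrier X; y \<in> ncarrier X\<rbrakk> \<Longrightarrow> nadd X x y = nadd X y x"
    and add_zero: "\<And>x. x \<in> ncarrier X \<Longrightarrow> nadd X (nzero X) x = x"
    and add_neg: "\<And>x. x \<in> ncarrier X \<Longrightarrow> nadd X x (nscale X (-1) x) = nzero X"
    and scale_add_right: "\<And>c x y. \<lbrakk>x \<in> ncarrier X; y \<in> ncarrier X\<rbrakk>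
          \<Longrightarrow> nscale X c (nadd X x y) = nadd X (nscale X c x) (nscale X c y)"
    and scale_add_left: "\<And>c d x. x \<in> ncarrier X
          \<Longrightarrow> nscale X (c + d) x = nadd X (nscale X c x) (nscale X d x)"
    and scale_scale: "\<And>c d x. x \<in> ncarrier X \<Longrightarrow> nscale X c (nscale X d x) = nscale X (c * d) x"
    and scale_one: "\<And>x. x \<in> ncarrier X \<Longrightarrow> nscale X 1 x = x"
    and norm_nonneg: "\<And>x. x \<in> ncarrier X \<Longrightarrow> 0 \<le> nnorm X x"
    and norm_eq_zero: "\<And>x. x \<in> ncarrier X \<Longrightarrow> nnorm X x = 0 \<longleftrightarrow> x = nzero X"
    and norm_scale: "\<And>c x. x \<in> ncarrier X \<Longrightarrow> nnorm X (nscale X c x) = \<bar>c\<bar> * nnorm X x"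
    and norm_triangle: "\<And>x y. \<lbrakk>x \<in> ncarrier X; y \<in> ncarrier X\<rbrakk>
          \<Longrightarrow> nnorm X (nadd X x y) \<le> nnorm X x + nnorm X y"

text \<open>The value outside the carrier only serves to meet the axioms of \<open>Metric_space\<close>, which
  require nonnegativity and symmetry of the distance on the whole type.\<close>

definition ndist :: "'a nspace \<Rightarrow> 'a \<Rightarrow> 'a \<Rightarrow> real" where
  "ndist X x y = (if x \<in> ncarrier X \<and> y \<in> ncarrier X
     then nnorm X (nadd X x (nscale X (-1) y)) else 0)"

definition ntopology :: "'a nspace \<Rightarrow> 'a topology" where
  "ntopology X = Metric_space.mtopology (ncarrier X) (ndist X)"

definition nlinear :: "'a nspace \<Rightarrow> 'b nspace \<Rightarrow> ('a \<Rightarrow> 'b) \<Rightarrow> bool" where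
  "nlinear X Y T \<longleftrightarrow>
     T \<in> ncarrier X \<rightarrow> ncarrier Y \<and>
     (\<forall>x\<in>ncarrier X. \<forall>y\<in>ncarrier X. T (nadd X x y) = nadd Y (T x) (T y)) \<and>
     (\<forall>c. \<forall>x\<in>ncarrier X. T (nscale X c x) = nscale Y c (T x))"

definition isomorphic_nspace :: "'a nspace \<Rightarrow> 'b nspace \<Rightarrow> bool" where
  "isomorphic_nspace X Y \<longleftrightarrow>
     (\<exists>T. nlinear X Y T \<and> homeomorphic_map (ntopology X) (ntopology Y) T)"

definition subspace_nspace :: "'a::real_normed_vector set \<Rightarrow> 'a nspace" where
  "subspace_nspace Y =
     \<lparr>ncarrier = Y, nadd = (+), nzero = 0, nscale = (*\<^sub>R), nnorm = norm\<rparr>"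

abbreviation real_nspace :: "real nspace" where
  "real_nspace \<equiv> subspace_nspace UNIV"

definition l1_nspace :: "(nat \<Rightarrow> real) nspace" where
  "l1_nspace =
     \<lparr>ncarrier = {a. summable (\<lambda>n. \<bar>a n\<bar>)},
      nadd = (\<lambda>a b n. a n + b n),
      nzero = (\<lambda>n. 0),
      nscale = (\<lambda>c a n. c * a n),
      nnorm = (\<lambda>a. \<Sum>n. \<bar>a n\<bar>)\<rparr>"

definition contains_l1 :: "'a::real_normed_vector set \<Rightarrow> bool" where
  "contains_l1 Z \<longleftrightarrow>
     (\<exists>Y. subspace Y \<and> Y \<subseteq> Z \<and> isomorphic_nspace (subspace_nspace Y) l1_nspace)"

text \<open>The points of the quotient are the cosets \<open>f + Z\<close>. Adding \<open>Z\<close> in the scalar multiplication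
  matters only for the scalar \<open>0\<close>, where the pointwise multiple of a coset would be \<open>{0}\<close>.\<close>

definition quotient_nspace :: "'a::real_normed_vector set \<Rightarrow> 'a set nspace" where
  "quotient_nspace Z =
     \<lparr>ncarrier = range (\<lambda>f. (+) f ` Z),
      nadd = (\<lambda>A B. {a + b |a b. a \<in> A \<and> b \<in> B}),
      nzero = Z,
      nscale = (\<lambda>c A. {c *\<^sub>R a + z |a z. a \<in> A \<and> z \<in> Z}),
      nnorm = (\<lambda>A. INF a\<in>A. norm a)\<rparr>"


section \<open>The slice diameter two property\<close>

definition nball :: "'a nspace \<Rightarrow> 'a set" where
  "nball X = {x \<in> ncarrier X. nnorm X x \<le> 1}"

text \<open>Elements of the dual are represented by functions on the whole type; only their values on
  the carrier matter.\<close>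

definition ndual :: "'a nspace \<Rightarrow> ('a \<Rightarrow> real) set" where
  "ndual X = {\<phi>. nlinear X real_nspace \<phi> \<and> continuous_map (ntopology X) euclideanreal \<phi>}"

definition dual_norm :: "'a nspace \<Rightarrow> ('a \<Rightarrow> real) \<Rightarrow> real" where
  "dual_norm X \<phi> = (SUP x\<in>nball X. \<bar>\<phi> x\<bar>)"

definition ndual_sphere :: "'a nspace \<Rightarrow> ('a \<Rightarrow> real) set" where
  "ndual_sphere X = {\<phi> \<in> ndual X. dual_norm X \<phi> = 1}"

definition nslice :: "'a nspace \<Rightarrow> ('a \<Rightarrow> real) \<Rightarrow> real \<Rightarrow> 'a set" where
  "nslice X \<phi> \<epsilon> = {x \<in> nball X. \<phi> x > 1 - \<epsilon>}"

text \<open>As for \<open>diameter\<close>, the empty set has diameter \<open>0\<close>.\<close>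

definition ndiameter :: "'a nspace \<Rightarrow> 'a set \<Rightarrow> real" where
  "ndiameter X S = (if S = {} then 0 else SUP (x, y)\<in>S \<times> S. ndist X x y)"

definition slice_diameter_two :: "'a nspace \<Rightarrow> bool" where
  "slice_diameter_two X \<longleftrightarrow>
     (\<forall>\<phi>\<in>ndual_sphere X. \<forall>\<epsilon>>0. ndiameter X (nslice X \<phi> \<epsilon>) = 2)"


section \<open>The structures above are normed spaces\<close>

lemma normed_space_on_subspace:
  "subspace Y \<Longrightarrow> normed_space_on (subspace_nspace Y)"
  by unfold_locales
    (auto simp: subspace_nspace_def subspace_add subspace_scale subspace_0 algebra_simps
      norm_triangle_ineq)

lemma normed_space_on_l1: "normed_space_on l1_nspace"
proof -
  have sum: "summable (\<lambda>n. \<bar>a n + b n\<bar>)"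
    if "summable (\<lambda>n. \<bar>a n\<bar>)" "summable (\<lambda>n. \<bar>b n\<bar>)" for a b :: "nat \<Rightarrow> real"
    by (rule summable_comparison_test'[OF summable_add[OF that], of 0]) auto
  show ?thesis
  proof (unfold_locales, goal_cases)
    case (13 a)
    then show ?case
      by (auto simp: l1_nspace_def suminf_eq_zero_iff)
  next
    case (15 a b)
    then have "(\<Sum>n. \<bar>a n + b n\<bar>) \<le> (\<Sum>n. \<bar>a n\<bar> + \<bar>b n\<bar>)"
      by (intro suminf_le) (auto simp: l1_nspace_def sum summable_add)
    with 15 show ?case
      by (simp add: l1_nspace_def suminf_add)
  qed (auto simp: l1_nspace_def sum algebra_simps abs_mult suminf_mult summable_mult suminf_nonneg)
qed

lemma Metric_space_ndist:
  assumes "normed_space_on X"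
  shows "Metric_space (ncarrier X) (ndist X)"
proof -
  interpret normed_space_on X by fact
  let ?m = "nscale X (-1)"
  have minus_minus: "?m (?m x) = x" if "x \<in> ncarrier X" for x
    using that by (simp add: scale_scale scale_one)
  have cancel: "nadd X (nadd X x (?m y)) y = x" if "x \<in> ncarrier X" "y \<in> ncarrier X" for x y
    using that by (metis add_assoc add_commute add_neg add_zero scale_closed zero_closed)
  show ?thesis
  proof
    fix x y
    show "0 \<le> ndist X x y"
      by (simp add: ndist_def norm_nonneg add_closed scale_closed)
    show "ndist X x y = ndist X y x"
    proof (cases "x \<in> ncarrier X \<and> y \<in> ncarrier X")
      case True
      then have "nadd X x (?m y) = ?m (nadd X y (?m x))"
        by (simp add: scale_add_right minus_minus scale_closed add_commute)
      with True show ?thesis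
        by (simp add: ndist_def norm_scale add_closed scale_closed)
    qed (auto simp: ndist_def)
  next
    fix x y assume xy: "x \<in> ncarrier X" "y \<in> ncarrier X"
    have "nadd X x (?m y) = nzero X \<longleftrightarrow> x = y"
      using xy by (metis add_neg add_zero cancel)
    with xy show "ndist X x y = 0 \<longleftrightarrow> x = y"
      by (simp add: ndist_def norm_eq_zero add_closed scale_closed)
  next
    fix x y z assume xyz: "x \<in> ncarrier X" "y \<in> ncarrier X" "z \<in> ncarrier X"
    then have "nadd X x (?m z) = nadd X (nadd X x (?m y)) (nadd X y (?m z))"
      by (metis add_assoc add_closed cancel scale_closed)
    with xyz show "ndist X x z \<le> ndist X x y + ndist X y z"
      by (simp add: ndist_def norm_triangle add_closed scale_closed)
  qed
qed

lemma normed_space_on_quotient: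
  fixes Z :: "'a::real_normed_vector set"
  assumes "subspace Z" "closed Z"
  shows "normed_space_on (quotient_nspace Z)"
proof -
  let ?q = "\<lambda>f. (+) f ` Z"
  note Z = subspace_0[OF assms(1)] subspace_add[OF assms(1)] subspace_diff[OF assms(1)]
    subspace_scale[OF assms(1)] subspace_neg[OF assms(1)]
  have mem: "x \<in> ?q f \<longleftrightarrow> x - f \<in> Z" for x f
    by (auto simp: image_iff algebra_simps) (metis add_diff_cancel_left' add.commute diff_add_cancel)
  have zero: "?q 0 = Z" by simp
  have add: "nadd (quotient_nspace Z) (?q f) (?q g) = ?q (f + g)" for f g
  proof (intro set_eqI iffI)
    fix x assume "x \<in> nadd (quotient_nspace Z) (?q f) (?q g)"
    then obtain a b where "a \<in> Z" "b \<in> Z" "x = (f + a) + (g + b)"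
      by (auto simp: quotient_nspace_def)
    then show "x \<in> ?q (f + g)" by (simp add: mem Z algebra_simps)
  next
    fix x assume "x \<in> ?q (f + g)"
    then obtain a where a: "a \<in> Z" "x = (f + a) + (g + 0)" by (auto simp: algebra_simps)
    have "f + a \<in> ?q f" "g + 0 \<in> ?q g" using a(1) Z(1) by blast+
    with a(2) show "x \<in> nadd (quotient_nspace Z) (?q f) (?q g)"
      unfolding quotient_nspace_def by auto
  qed
  have scale: "nscale (quotient_nspace Z) c (?q f) = ?q (c *\<^sub>R f)" for c f
  proof (intro set_eqI iffI)
    fix x assume "x \<in> nscale (quotient_nspace Z) c (?q f)"
    then obtain a b where "a \<in> Z" "b \<in> Z" "x = c *\<^sub>R (f + a) + b"
      by (auto simp: quotient_nspace_def)
    then show "x \<in> ?q (c *\<^sub>R f)" by (simp add: mem Z algebra_simps)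
  next
    fix x assume "x \<in> ?q (c *\<^sub>R f)"
    then obtain a where a: "a \<in> Z" "x = c *\<^sub>R (f + 0) + a" by auto
    have "f + 0 \<in> ?q f" using Z(1) by blast
    with a show "x \<in> nscale (quotient_nspace Z) c (?q f)"
      unfolding quotient_nspace_def by auto
  qed
  have norm: "nnorm (quotient_nspace Z) (?q f) = infdist f Z" for f
  proof -
    have "(\<lambda>z. norm (f + z)) ` Z = dist f ` Z"
    proof (intro set_eqI iffI)
      fix r assume "r \<in> (\<lambda>z. norm (f + z)) ` Z"
      then obtain z where "z \<in> Z" "r = norm (f + z)" by auto
      then show "r \<in> dist f ` Z" by (intro image_eqI[of _ _ "-z"]) (auto simp: dist_norm Z)
    next
      fix r assume "r \<in> dist f ` Z"
      then obtain z where "z \<in> Z" "r = norm (f - z)" by (auto simp: dist_norm)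
      then show "r \<in> (\<lambda>z. norm (f + z)) ` Z" by (intro image_eqI[of _ _ "-z"]) (auto simp: Z)
    qed
    moreover have "Z \<noteq> {}" using Z(1) by auto
    ultimately show ?thesis
      by (simp add: quotient_nspace_def infdist_def image_image)
  qed
  have near: "\<exists>z\<in>Z. norm (f - z) < infdist f Z + e" if "e > 0" for f e
  proof -
    have "Z \<noteq> {}" using Z(1) by auto
    then have "(INF z\<in>Z. dist f z) < infdist f Z + e"
      using that by (simp add: infdist_def)
    then have "\<exists>z\<in>Z. dist f z < infdist f Z + e"
      by (subst (asm) cINF_less_iff) (use \<open>Z \<noteq> {}\<close> in \<open>auto intro!: bdd_belowI[of _ 0]\<close>)
    then show ?thesis by (simp add: dist_norm)
  qed
  have infdist_le_norm: "infdist f Z \<le> norm (f - z)" if "z \<in> Z" for f z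
    using infdist_le[OF that, of f] by (simp add: dist_norm)
  have scale_le: "infdist (c *\<^sub>R f) Z \<le> \<bar>c\<bar> * infdist f Z" for c f
  proof (rule field_le_epsilon)
    fix e :: real assume e: "e > 0"
    define d where "d = e / (\<bar>c\<bar> + 1)"
    have d: "d > 0" "\<bar>c\<bar> * d \<le> e" using e by (auto simp: d_def field_simps)
    obtain z where z: "z \<in> Z" "norm (f - z) < infdist f Z + d" using near[OF d(1)] by blast
    have "infdist (c *\<^sub>R f) Z \<le> norm (c *\<^sub>R f - c *\<^sub>R z)"
      using z Z(4) infdist_le_norm by blast
    also have "\<dots> = \<bar>c\<bar> * norm (f - z)" by (simp flip: scaleR_diff_right)
    also have "\<dots> \<le> \<bar>c\<bar> * (infdist f Z + d)" using z by (intro mult_left_mono) auto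
    finally show "infdist (c *\<^sub>R f) Z \<le> \<bar>c\<bar> * infdist f Z + e"
      using d by (simp add: algebra_simps)
  qed
  have norm_scale: "infdist (c *\<^sub>R f) Z = \<bar>c\<bar> * infdist f Z" for c f
  proof (cases "c = 0")
    case True
    then show ?thesis using Z(1) by simp
  next
    case False
    have "\<bar>c\<bar> * infdist (inverse c *\<^sub>R c *\<^sub>R f) Z \<le> \<bar>c\<bar> * (\<bar>inverse c\<bar> * infdist (c *\<^sub>R f) Z)"
      by (intro mult_left_mono scale_le) auto
    with False have "\<bar>c\<bar> * infdist f Z \<le> infdist (c *\<^sub>R f) Z"
      by (simp add: field_simps)
    then show ?thesis using scale_le[of c f] by simp
  qed
  have norm_add: "infdist (f + g) Z \<le> infdist f Z + infdist g Z" for f g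
  proof (rule field_le_epsilon)
    fix e :: real assume e: "e > 0"
    obtain z where z: "z \<in> Z" "norm (f - z) < infdist f Z + e/2" using near[of "e/2"] e by auto
    obtain w where w: "w \<in> Z" "norm (g - w) < infdist g Z + e/2" using near[of "e/2"] e by auto
    have "infdist (f + g) Z \<le> norm ((f + g) - (z + w))"
      using z w Z(2) infdist_le_norm by blast
    also have "\<dots> \<le> norm (f - z) + norm (g - w)"
      using norm_triangle_ineq[of "f - z" "g - w"] by (simp add: algebra_simps)
    finally show "infdist (f + g) Z \<le> infdist f Z + infdist g Z + e" using z w by simp
  qed
  have norm_zero: "infdist f Z = 0 \<longleftrightarrow> ?q f = Z" for f
  proof -
    have "infdist f Z = 0 \<longleftrightarrow> f \<in> Z"
      using in_closed_iff_infdist_zero[OF assms(2)] Z(1) by auto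
    also have "f \<in> Z \<longleftrightarrow> ?q f = Z"
    proof
      assume f: "f \<in> Z"
      show "?q f = Z"
      proof (intro set_eqI iffI)
        fix x assume "x \<in> ?q f"
        then show "x \<in> Z" using f Z(2) by auto
      next
        fix x assume "x \<in> Z"
        then show "x \<in> ?q f" using f Z(3) by (simp only: mem)
      qed
    next
      assume "?q f = Z"
      moreover have "f \<in> ?q f" using Z(1) by (simp only: mem) simp
      ultimately show "f \<in> Z" by simp
    qed
    finally show ?thesis .
  qed
  have carrier: "ncarrier (quotient_nspace Z) = range ?q"
    and nzero: "nzero (quotient_nspace Z) = ?q 0"
    by (simp_all add: quotient_nspace_def)
  have norm_zero': "infdist f Z = 0 \<longleftrightarrow> ?q f = ?q 0" for f
    using norm_zero by simp
  have pos: "infdist f Z \<ge> 0" for f by (rule infdist_nonneg)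
  show ?thesis
  proof (unfold_locales, goal_cases)
    case (7 x)
    then obtain f where "x = ?q f" unfolding carrier by blast
    then show ?case unfolding nzero by (simp only: add scale) simp
  next
    case (13 x)
    then obtain f where "x = ?q f" unfolding carrier by blast
    then show ?case unfolding nzero by (simp only: norm norm_zero')
  qed (unfold carrier nzero,
       auto simp only: add scale norm norm_scale norm_add pos algebra_simps add_0_left add_0_right
         scaleR_scaleR scaleR_one intro!: rangeI)
qed

end

theory Submission
  imports Defs
begin

text \<open>A functional on the quotient is a functional \<open>\<Phi>\<close> on \<open>C[0,1]\<close> vanishing on \<open>Z\<close>. Take \<open>f\<close> in
  the unit ball with \<open>\<Phi> f > 1 - \<epsilon>\<close>. There is a small interval inside which \<open>f\<close> can be replaced by
  any function of norm at most 1 almost without changing \<open>\<Phi> f\<close>. On it, insert \<open>r n\<close> and \<open>- r n\<close>,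
  where \<open>r 0, r 1, ...\<close> are Rademacher-like functions realising every sequence of signs at some
  common point. If the slice had diameter less than \<open>d < 2\<close>, some \<open>z n \<in> Z\<close> would lie within \<open>d\<close> of
  the difference of the two modified functions, which is \<open>2 * r n\<close> on the middle of the interval. So
  \<open>z n\<close> has there the sign of \<open>r n\<close> and modulus at least \<open>2 - d\<close> wherever \<open>r n = \<plusminus>1\<close>; thus the \<open>z n\<close>
  are equivalent to the unit vector basis of \<open>l1\<close>.\<close>

section \<open>Bounded linear maps and functionals\<close>

lemma nlinear_diff:
  assumes "normed_space_on X" "nlinear X Y T" "x \<in> ncarrier X" "y \<in> ncarrier X"
  shows "T (nadd X x (nscale X (-1) y)) = nadd Y (T x) (nscale Y (-1) (T y))"
  using assms normed_space_on.scale_closed[OF assms(1), of y "-1"]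
  unfolding nlinear_def by auto

text \<open>Linearity turns the bound on norms into a Lipschitz estimate for
  \<open>ndist\<close>.\<close>

lemma continuous_map_nlinear:
  assumes X: "normed_space_on X" and Y: "normed_space_on Y" and T: "nlinear X Y T"
    and bound: "\<And>x. x \<in> ncarrier X \<Longrightarrow> nnorm Y (T x) \<le> C * nnorm X x"
  shows "continuous_map (ntopology X) (ntopology Y) T"
proof -
  interpret X: normed_space_on X by fact
  have maps: "T x \<in> ncarrier Y" if "x \<in> ncarrier X" for x
    using T that by (auto simp: nlinear_def)
  have le: "ndist Y (T a) (T x) \<le> C * ndist X a x" if "a \<in> ncarrier X" "x \<in> ncarrier X" for a x
    using that bound[of "nadd X a (nscale X (-1) x)"]
    by (simp add: ndist_def maps nlinear_diff[OF X T] X.add_closed X.scale_closed)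
  have "\<exists>\<delta>>0. \<forall>x. x \<in> ncarrier X \<and> ndist X a x < \<delta> \<longrightarrow> ndist Y (T a) (T x) < \<epsilon>"
    if a: "a \<in> ncarrier X" and \<epsilon>: "\<epsilon> > 0" for a and \<epsilon> :: real
  \<comment> \<open>\<open>C\<close> may be zero or negative, so \<open>\<bar>C\<bar> + 1\<close>
    serves as a positive Lipschitz constant.\<close>
  proof (intro exI[of _ "\<epsilon> / (\<bar>C\<bar> + 1)"] conjI allI impI)
    show "\<epsilon> / (\<bar>C\<bar> + 1) > 0" using \<epsilon> by simp
    fix x assume x: "x \<in> ncarrier X \<and> ndist X a x < \<epsilon> / (\<bar>C\<bar> + 1)"
    have nonneg: "ndist X a x \<ge> 0"
      using Metric_space.nonneg[OF Metric_space_ndist[OF X]] .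
    have "ndist Y (T a) (T x) \<le> C * ndist X a x" using a x le by blast
    also have "\<dots> \<le> (\<bar>C\<bar> + 1) * ndist X a x" by (intro mult_right_mono nonneg) simp
    also have "\<dots> < \<epsilon>" using x by (simp add: field_simps)
    finally show "ndist Y (T a) (T x) < \<epsilon>" .
  qed
  then show ?thesis
    unfolding ntopology_def
    by (subst Metric_space.metric_continuous_map[OF Metric_space_ndist[OF X] Metric_space_ndist[OF Y]])
       (auto simp: maps)
qed

text \<open>The lower bound makes \<open>S\<close> injective and bounds its inverse by
  \<open>inverse c\<close>; the upper bound makes \<open>S\<close> continuous. \<open>S\<close> runs
  from \<open>Y\<close> to \<open>X\<close> because in the application \<open>Y\<close> is
  \<open>l1_nspace\<close> and \<open>S\<close> sums a series, while the isomorphism sought is its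
  inverse.\<close>

lemma isomorphic_nspaceI:
  assumes X: "normed_space_on X" and Y: "normed_space_on Y" and S: "nlinear Y X S"
    and onto: "S ` ncarrier Y = ncarrier X"
    and upper: "\<And>y. y \<in> ncarrier Y \<Longrightarrow> nnorm X (S y) \<le> C * nnorm Y y"
    and lower: "\<And>y. y \<in> ncarrier Y \<Longrightarrow> c * nnorm Y y \<le> nnorm X (S y)"
    and c: "c > 0"
  shows "isomorphic_nspace X Y"
proof -
  interpret X: normed_space_on X by fact
  interpret Y: normed_space_on Y by fact
  have S_closed: "S y \<in> ncarrier X" if "y \<in> ncarrier Y" for y
    using that onto by blast
  have inj: "inj_on S (ncarrier Y)"
  proof (rule inj_onI)
    fix x y assume xy: "x \<in> ncarrier Y" "y \<in> ncarrier Y" "S x = S y"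
    let ?d = "nadd Y x (nscale Y (-1) y)"
    have d: "?d \<in> ncarrier Y" using xy by (simp add: Y.add_closed Y.scale_closed)
    have "S ?d = nadd X (S x) (nscale X (-1) (S y))" using nlinear_diff[OF Y S] xy by simp
    also have "\<dots> = nzero X" using xy by (simp add: X.add_neg S_closed)
    finally have "nnorm X (S ?d) = 0" using X.norm_eq_zero X.zero_closed by simp
    then have "c * nnorm Y ?d \<le> 0" using lower[OF d] by simp
    then have "nnorm Y ?d = 0"
      using c Y.norm_nonneg[OF d] by (simp add: mult_le_0_iff)
    then have "ndist Y x y = 0" using xy by (simp add: ndist_def)
    then show "x = y" using Metric_space.zero[OF Metric_space_ndist[OF Y]] xy by simp
  qed
  define T where "T = inv_into (ncarrier Y) S"
  have T_closed: "T x \<in> ncarrier Y" and ST: "S (T x) = x" if "x \<in> ncarrier X" for x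
    using that onto by (auto simp: T_def inv_into_into f_inv_into_f)
  have TS: "T (S y) = y" if "y \<in> ncarrier Y" for y
    using that inj by (simp add: T_def)
  have T: "nlinear X Y T"
    unfolding nlinear_def
  proof (intro conjI ballI allI)
    show "T \<in> ncarrier X \<rightarrow> ncarrier Y" using T_closed by blast
    fix x y assume xy: "x \<in> ncarrier X" "y \<in> ncarrier X"
    have "nadd X x y = S (nadd Y (T x) (T y))"
      using S xy by (simp add: nlinear_def T_closed ST)
    then show "T (nadd X x y) = nadd Y (T x) (T y)"
      using xy by (simp add: TS Y.add_closed T_closed)
  next
    fix a x assume x: "x \<in> ncarrier X"
    have "nscale X a x = S (nscale Y a (T x))"
      using S x by (simp add: nlinear_def T_closed ST)
    then show "T (nscale X a x) = nscale Y a (T x)"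
      using x by (simp add: TS Y.scale_closed T_closed)
  qed
  have T_bound: "nnorm Y (T x) \<le> inverse c * nnorm X x" if "x \<in> ncarrier X" for x
    using lower[OF T_closed[OF that]] c by (simp add: ST that field_simps)
  have "homeomorphic_maps (ntopology X) (ntopology Y) T S"
    unfolding homeomorphic_maps_def
  proof (intro conjI ballI)
    show "continuous_map (ntopology X) (ntopology Y) T"
      by (rule continuous_map_nlinear[OF X Y T T_bound])
    show "continuous_map (ntopology Y) (ntopology X) S"
      by (rule continuous_map_nlinear[OF Y X S upper])
  qed (auto simp: ntopology_def ST TS
        Metric_space.topspace_mtopology[OF Metric_space_ndist[OF X]]
        Metric_space.topspace_mtopology[OF Metric_space_ndist[OF Y]])
  then show ?thesis
    unfolding isomorphic_nspace_def using T homeomorphic_maps_imp_map by blast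
qed

text \<open>Being a supremum of reals, \<open>dual_norm\<close> controls \<open>\<phi>\<close> only
  once this set is known to be bounded. Continuity at the zero vector bounds \<open>\<phi>\<close>
  on a small ball, and scaling carries the bound to \<open>nball X\<close>.\<close>

lemma ndual_bdd_above:
  assumes X: "normed_space_on X" and \<phi>: "\<phi> \<in> ndual X"
  shows "bdd_above ((\<lambda>x. \<bar>\<phi> x\<bar>) ` nball X)"
proof -
  interpret X: normed_space_on X by fact
  have lin: "nlinear X real_nspace \<phi>" and cont: "continuous_map (ntopology X) euclideanreal \<phi>"
    using \<phi> by (auto simp: ndual_def)
  have scale: "\<phi> (nscale X a x) = a * \<phi> x" if "x \<in> ncarrier X" for a x
    using lin that by (simp add: nlinear_def subspace_nspace_def)
  have zero: "\<phi> (nzero X) = 0"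
  proof -
    have "\<phi> (nadd X (nzero X) (nzero X)) = \<phi> (nzero X) + \<phi> (nzero X)"
      using lin X.zero_closed by (simp add: nlinear_def subspace_nspace_def)
    then show ?thesis unfolding X.add_zero[OF X.zero_closed] by simp
  qed
  have "\<forall>a\<in>ncarrier X. \<forall>\<epsilon>>0. \<exists>\<delta>>0. \<forall>x. x \<in> ncarrier X \<and> ndist X a x < \<delta> \<longrightarrow> dist (\<phi> a) (\<phi> x) < \<epsilon>"
    using cont Metric_space.metric_continuous_map[OF Metric_space_ndist[OF X] Met_TC.Metric_space_axioms, of \<phi>]
    by (simp add: ntopology_def)
  from this[rule_format, OF X.zero_closed zero_less_one] obtain \<delta> where \<delta>: "\<delta> > 0"
    and small: "\<And>x. x \<in> ncarrier X \<Longrightarrow> ndist X (nzero X) x < \<delta> \<Longrightarrow> \<bar>\<phi> x\<bar> < 1"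
    unfolding zero dist_real_def by auto
  have "\<bar>\<phi> x\<bar> \<le> 2 / \<delta>" if x: "x \<in> nball X" for x
  proof -
    have x': "x \<in> ncarrier X" "nnorm X x \<le> 1" using x by (auto simp: nball_def)
    \<comment> \<open>The factor is half of \<open>\<delta>\<close> because \<open>x\<close> may
      have norm 1 and \<open>small\<close> asks for a strict inequality.\<close>
    let ?y = "nscale X (\<delta>/2) x"
    have y: "?y \<in> ncarrier X" using x' X.scale_closed by blast
    have "ndist X (nzero X) ?y = \<delta>/2 * nnorm X x"
      using x' y \<delta> X.zero_closed by (simp add: ndist_def X.add_zero X.scale_closed X.norm_scale)
    also have "\<dots> \<le> \<delta>/2 * 1" using x' \<delta> by (intro mult_left_mono) auto
    finally have "\<bar>\<phi> ?y\<bar> < 1" using y small \<delta> by simp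
    then show ?thesis using x' \<delta> by (simp add: scale abs_mult field_simps)
  qed
  then show ?thesis by (auto intro!: bdd_aboveI)
qed

section \<open>Sequences spanning a copy of \<open>l1\<close>\<close>

text \<open>The synthesis operator \<open>S\<close>, sending coefficients \<open>a\<close> to the
  sum of \<open>a n *\<^sub>R e n\<close>, is bounded above by \<open>bound\<close> and below by
  \<open>lower\<close>. As \<open>Z\<close> is closed, it contains the sums of these series.\<close>

lemma contains_l1I:
  fixes e :: "nat \<Rightarrow> 'a::banach"
  assumes Z: "subspace Z" "closed Z" "\<And>n. e n \<in> Z"
    and bound: "\<And>n. norm (e n) \<le> C"
    and lower: "\<And>a. summable (\<lambda>n. \<bar>a n\<bar>) \<Longrightarrow> c * (\<Sum>n. \<bar>a n\<bar>) \<le> norm (\<Sum>n. a n *\<^sub>R e n)"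
    and c: "c > 0"
  shows "contains_l1 Z"
proof -
  define S where "S a = (\<Sum>n. a n *\<^sub>R e n)" for a
  let ?A = "ncarrier l1_nspace"
  interpret l1: normed_space_on l1_nspace by (rule normed_space_on_l1)
  have norm_le: "norm (a n *\<^sub>R e n) \<le> C * \<bar>a n\<bar>" for a n
    using mult_right_mono[OF bound[of n] abs_ge_zero[of "a n"]] by (simp add: mult.commute)
  have A: "a \<in> ?A \<longleftrightarrow> summable (\<lambda>n. \<bar>a n\<bar>)" for a by (simp add: l1_nspace_def)
  have summ: "summable (\<lambda>n. norm (a n *\<^sub>R e n))" if "a \<in> ?A" for a
  proof (rule summable_comparison_test'[where N = 0])
    show "summable (\<lambda>n. C * \<bar>a n\<bar>)" using that by (intro summable_mult) (simp add: A)
    show "norm (norm (a n *\<^sub>R e n)) \<le> C * \<bar>a n\<bar>" for n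
      using norm_le[of a n] by (simp del: norm_scaleR)
  qed
  have summ': "summable (\<lambda>n. a n *\<^sub>R e n)" if "a \<in> ?A" for a
    using summ[OF that] by (rule summable_norm_cancel)
  have S_add: "S (nadd l1_nspace a b) = S a + S b" if "a \<in> ?A" "b \<in> ?A" for a b
    using suminf_add[OF summ'[OF that(1)] summ'[OF that(2)]]
    by (simp add: S_def l1_nspace_def scaleR_add_left)
  have S_scale: "S (nscale l1_nspace r a) = r *\<^sub>R S a" if "a \<in> ?A" for r a
    using suminf_scaleR_right[OF summ'[OF that], of r]
    by (simp add: S_def l1_nspace_def)
  have S_Z: "S a \<in> Z" if "a \<in> ?A" for a
  proof -
    have "(\<lambda>n. \<Sum>i<n. a i *\<^sub>R e i) \<longlonglongrightarrow> S a"
      unfolding S_def using summ'[OF that] by (rule summable_LIMSEQ)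
    moreover have "(\<Sum>i<n. a i *\<^sub>R e i) \<in> Z" for n
      using Z by (intro subspace_sum subspace_scale) auto
    ultimately show ?thesis by (rule closed_sequentially[OF Z(2), rotated])
  qed
  have sub: "subspace (S ` ?A)"
  proof (rule subspaceI)
    have "S (nzero l1_nspace) = 0" by (simp add: S_def l1_nspace_def)
    then show "0 \<in> S ` ?A" using l1.zero_closed by (metis imageI)
  next
    fix x y assume "x \<in> S ` ?A" "y \<in> S ` ?A"
    then show "x + y \<in> S ` ?A" using S_add l1.add_closed 
      by (metis (no_types, lifting) imageE imageI)
  next
    fix r x assume "x \<in> S ` ?A"
    then show "r *\<^sub>R x \<in> S ` ?A" using S_scale l1.scale_closed 
      by (metis (no_types, lifting) imageE imageI)
  qed
  have "isomorphic_nspace (subspace_nspace (S ` ?A)) l1_nspace"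
  proof (rule isomorphic_nspaceI[OF normed_space_on_subspace[OF sub] normed_space_on_l1 _ _ _ _ c, where S = S and C = C])
    show "nlinear l1_nspace (subspace_nspace (S ` ?A)) S"
      using S_add S_scale by (auto simp: nlinear_def subspace_nspace_def)
    show "S ` ?A = ncarrier (subspace_nspace (S ` ?A))" by (simp add: subspace_nspace_def)
    fix a assume a: "a \<in> ?A"
    have "norm (S a) \<le> (\<Sum>n. norm (a n *\<^sub>R e n))"
      unfolding S_def by (rule summable_norm[OF summ[OF a]])
    also have "\<dots> \<le> (\<Sum>n. C * \<bar>a n\<bar>)"
      using a by (intro suminf_le norm_le summ summable_mult) (auto simp: A)
    also have "\<dots> = C * (\<Sum>n. \<bar>a n\<bar>)" using a by (intro suminf_mult) (simp add: A)
    finally show "nnorm (subspace_nspace (S ` ?A)) (S a) \<le> C * nnorm l1_nspace a"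
      by (simp add: subspace_nspace_def l1_nspace_def)
    show "c * nnorm l1_nspace a \<le> nnorm (subspace_nspace (S ` ?A)) (S a)"
      using lower[of a] a by (simp add: A S_def subspace_nspace_def l1_nspace_def)
  qed
  moreover have "S ` ?A \<subseteq> Z" using S_Z by blast
  ultimately show ?thesis unfolding contains_l1_def using sub by blast
qed

instance bcontfun :: (metric_space, banach) banach ..

lemma abs_apply_le_norm:
  fixes f :: "'a::topological_space \<Rightarrow>\<^sub>C real"
  shows "\<bar>f t\<bar> \<le> norm f"
  using norm_bounded[of f t] by simp

text \<open>At a point \<open>t\<close> where the signs of the \<open>e n\<close> match those of the
  coefficients, no cancellation occurs: each term of the series is at least
  \<open>c * \<bar>a n\<bar>\<close>. The supremum norm dominates the value at
  \<open>t\<close>.\<close>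

lemma contains_l1_of_signs:
  fixes e :: "nat \<Rightarrow> 'a::metric_space \<Rightarrow>\<^sub>C real"
  assumes Z: "subspace Z" "closed Z" "\<And>n. e n \<in> Z"
    and bound: "\<And>n. norm (e n) \<le> C"
    and signs: "\<And>s :: nat \<Rightarrow> bool. \<exists>t. \<forall>n. (if s n then 1 else -1) * e n t \<ge> c"
    and c: "c > 0"
  shows "contains_l1 Z"
proof (rule contains_l1I[where e = e, OF Z bound _ c])
  fix a :: "nat \<Rightarrow> real" assume a: "summable (\<lambda>n. \<bar>a n\<bar>)"
  obtain t where t: "\<And>n. (if a n \<ge> 0 then 1 else -1) * e n t \<ge> c"
    using signs[of "\<lambda>n. a n \<ge> 0"] by auto
  have eval: "bounded_linear (\<lambda>f::'a \<Rightarrow>\<^sub>C real. f t)"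
    by (rule bounded_linear_intro[of _ 1]) (auto simp: abs_apply_le_norm)
  have "summable (\<lambda>n. norm (a n *\<^sub>R e n))"
  proof (rule summable_comparison_test'[where N = 0])
    show "summable (\<lambda>n. C * \<bar>a n\<bar>)" using a by (rule summable_mult)
    show "norm (norm (a n *\<^sub>R e n)) \<le> C * \<bar>a n\<bar>" for n
      using mult_right_mono[OF bound[of n] abs_ge_zero[of "a n"]] by (simp add: mult.commute)
  qed
  then have s: "summable (\<lambda>n. a n *\<^sub>R e n)" by (rule summable_norm_cancel)
  have "c * (\<Sum>n. \<bar>a n\<bar>) = (\<Sum>n. c * \<bar>a n\<bar>)" using a by (simp add: suminf_mult)
  also have "\<dots> \<le> (\<Sum>n. a n * e n t)"
  proof (rule suminf_le)
    fix n
    have "\<bar>a n\<bar> * c \<le> \<bar>a n\<bar> * ((if a n \<ge> 0 then 1 else -1) * e n t)"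
      by (intro mult_left_mono t) simp
    then show "c * \<bar>a n\<bar> \<le> a n * e n t" by (auto simp: mult.commute split: if_splits)
  next
    show "summable (\<lambda>n. c * \<bar>a n\<bar>)" using a by (rule summable_mult)
    show "summable (\<lambda>n. a n * e n t)"
      using bounded_linear.summable[OF eval s] by simp
  qed
  also have "\<dots> = (\<Sum>n. a n *\<^sub>R e n) t"
    using bounded_linear.suminf[OF eval s] by simp
  also have "\<dots> \<le> norm (\<Sum>n. a n *\<^sub>R e n)"
    using abs_apply_le_norm[of "\<Sum>n. a n *\<^sub>R e n" t] by simp
  finally show "c * (\<Sum>n. \<bar>a n\<bar>) \<le> norm (\<Sum>n. a n *\<^sub>R e n)" .
qed

section \<open>Independent oscillating functions\<close>

text \<open>Doubling and clamping give exactly 1 or -1 wherever the cosine has modulus at least 1/2.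
  This leaves whole intervals on which a sign is attained, hence room to prescribe all later
  signs.\<close>

definition clamped_cos :: "nat \<Rightarrow> real \<Rightarrow> real" where
  "clamped_cos n x = max (-1) (min 1 (2 * cos (2 * pi * (4 ^ n * x))))"

lemma abs_clamped_cos_le_1: "\<bar>clamped_cos n x\<bar> \<le> 1"
  by (auto simp: clamped_cos_def)

lemma continuous_on_clamped_cos [continuous_intros]:
  fixes f :: "'a::t2_space \<Rightarrow> real"
  shows "continuous_on A f \<Longrightarrow> continuous_on A (\<lambda>x. clamped_cos n (f x))"
  unfolding clamped_cos_def by (intro continuous_intros)

text \<open>The point sought has only the digits \<open>0\<close> and \<open>2\<close> in base 4; multiplication by \<open>4 ^ n\<close>
  moves digit \<open>n\<close> to the front, up to an integer, which the cosine ignores.\<close>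

lemma clamped_cos_independent:
  fixes s :: "nat \<Rightarrow> bool"
  obtains x where "0 \<le> x" "x \<le> 1" "\<And>n. clamped_cos n x = (if s n then 1 else -1)"
proof -
  \<comment> \<open>A leading digit 0 leaves the angle near 0, where the cosine is positive; a
    leading digit 2 adds half a turn and flips the sign.\<close>
  define d :: "nat \<Rightarrow> real" where "d k = (if s k then 0 else 2)" for k
  \<comment> \<open>\<open>S n\<close> has the base 4 digits \<open>d n\<close>,
    \<open>d (n + 1)\<close>, ... after the point; \<open>S 0\<close> is the point sought.\<close>
  define S where "S n = (\<Sum>k. d (k + n) * (1/4) ^ Suc k)" for n
  have geo: "(\<lambda>k. 2 * (1/4::real) ^ Suc k) sums (2/3)"
    using sums_mult[OF geometric_sums[of "1/4::real"], of "1/2"] by simp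
  have summ: "summable (\<lambda>k. d (k + n) * (1/4) ^ Suc k)" for n
    by (rule summable_comparison_test'[OF sums_summable[OF geo], of 0])
       (auto simp: d_def)
  have S_nonneg: "0 \<le> S n" for n
    unfolding S_def by (intro suminf_nonneg summ) (simp add: d_def)
  have S_le: "S n \<le> 2/3" for n
    unfolding S_def sums_unique[OF geo]
    by (intro suminf_le summ sums_summable[OF geo]) (simp add: d_def)
  have S_rec: "4 * S n = d n + S (Suc n)" for n
  proof -
    have "S n = (\<Sum>k. d (Suc k + n) * (1/4) ^ Suc (Suc k)) + d n / 4"
      unfolding S_def using suminf_split_head[OF summ[of n]] by simp
    also have "(\<Sum>k. d (Suc k + n) * (1/4) ^ Suc (Suc k)) = S (Suc n) / 4"
      unfolding S_def using suminf_mult[OF summ[of "Suc n"], of "1/4"] by (simp add: algebra_simps)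
    finally show ?thesis by simp
  qed
  have shift: "\<exists>m::int. 4 ^ n * S 0 = of_int m + S n" for n
  proof (induction n)
    case 0
    show ?case by (intro exI[of _ 0]) simp
  next
    case (Suc n)
    then obtain m :: int where m: "4 ^ n * S 0 = of_int m + S n" by blast
    have "4 ^ Suc n * S 0 = 4 * of_int m + 4 * S n" using m by simp
    also have "\<dots> = of_int (4 * m + (if s n then 0 else 2)) + S (Suc n)"
      unfolding S_rec by (simp add: d_def)
    finally show ?case by blast
  qed
  have cos_shift: "cos (2 * pi * (4 ^ n * S 0)) = cos (2 * pi * S n)" for n
  proof -
    obtain m :: int where m: "4 ^ n * S 0 = of_int m + S n" using shift by blast
    show ?thesis
      unfolding m using sin_cos_eq_iff[of "2 * pi * (of_int m + S n)" "2 * pi * S n"]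
      by (auto simp: algebra_simps)
  qed
  \<comment> \<open>The digits after digit \<open>n\<close> contribute at most a quarter of 2/3 to
    \<open>S n\<close>, that is 1/6 of a turn, or \<open>pi/3\<close>.\<close>
  have half: "cos y \<ge> 1/2" if "0 \<le> y" "y \<le> pi/3" for y :: real
    using cos_monotone_0_pi_le[of y "pi/3"] that cos_60 by simp
  have val: "clamped_cos n (S 0) = (if s n then 1 else -1)" for n
  proof (cases "s n")
    case True
    have eq: "S n = S (Suc n) / 4" using S_rec[of n] True by (simp add: d_def)
    have "cos (2 * pi * S n) \<ge> 1/2"
      using S_nonneg[of n] S_le[of "Suc n"] eq by (intro half) (auto simp: field_simps)
    then show ?thesis using True by (simp add: clamped_cos_def cos_shift)
  next
    case False
    have eq: "S n = 1/2 + S (Suc n) / 4" using S_rec[of n] False by (simp add: d_def)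
    have "cos (2 * pi * S n) = - cos (2 * pi * (S (Suc n) / 4))"
      unfolding eq using cos_periodic_pi2[of "2 * pi * (S (Suc n) / 4)"] by (simp add: algebra_simps)
    moreover have "cos (2 * pi * (S (Suc n) / 4)) \<ge> 1/2"
      using S_nonneg[of "Suc n"] S_le[of "Suc n"] by (intro half) (auto simp: field_simps)
    ultimately show ?thesis using False by (simp add: clamped_cos_def cos_shift)
  qed
  show thesis
    using that[of "S 0"] S_nonneg[of 0] S_le[of 0] val by simp
qed

section \<open>Perturbing a function on a small interval\<close>

lemma continuous_on_Rep_unit_interval [continuous_intros]:
  "continuous_on A Rep_unit_interval"
  unfolding continuous_on_iff by (auto simp: dist_unit_interval_def)

lemma apply_Bcontfun_unit_interval:
  fixes f :: "unit_interval \<Rightarrow> real"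
  assumes "continuous_on UNIV f"
  shows "apply_bcontfun (Bcontfun f) = f"
  using assms by (intro Bcontfun_inverse) (simp add: bcontfun_unit_interval)

lemma apply_bcontfun_sum:
  fixes f :: "'i \<Rightarrow> 'a::topological_space \<Rightarrow>\<^sub>C 'b::real_normed_vector"
  shows "(\<Sum>i\<in>I. f i) x = (\<Sum>i\<in>I. f i x)"
  by (induction I rule: infinite_finite_induct) auto

text \<open>A trapezoid in the rescaled coordinate \<open>N * x - i\<close>: zero outside the unit
  interval and 1 on its middle half.\<close>

definition bump :: "nat \<Rightarrow> nat \<Rightarrow> real \<Rightarrow> real" where
  "bump N i x = max 0 (min 1 (2 - \<bar>4 * (real N * x - real i) - 2\<bar>))"

lemma bump_bounds: "0 \<le> bump N i x" "bump N i x \<le> 1"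
  by (auto simp: bump_def)

lemma continuous_on_bump [continuous_intros]:
  fixes f :: "'a::t2_space \<Rightarrow> real"
  shows "continuous_on A f \<Longrightarrow> continuous_on A (\<lambda>x. bump N i (f x))"
  unfolding bump_def by (intro continuous_intros)

lemma bump_eq_1: "1/4 \<le> real N * x - real i \<Longrightarrow> real N * x - real i \<le> 3/4 \<Longrightarrow> bump N i x = 1"
  by (simp add: bump_def)

lemma bump_eq_0: "real N * x \<le> real i \<or> real i + 1 \<le> real N * x \<Longrightarrow> bump N i x = 0"
  by (auto simp: bump_def)

lemma sum_bump_le_1:
  assumes "x \<ge> 0"
  shows "(\<Sum>i<N. bump N i x) \<le> 1"
proof -
  \<comment> \<open>The supports overlap at most in endpoints, so only the index \<open>j\<close>
    can contribute.\<close>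
  define j where "j = nat \<lfloor>real N * x\<rfloor>"
  have j: "real j \<le> real N * x" "real N * x < real j + 1"
    using assms by (auto simp: j_def)
  have "bump N i x \<le> (if i = j then 1 else 0)" for i
  proof (cases "i = j")
    case False
    then have "real i + 1 \<le> real j \<or> real j + 1 \<le> real i" by linarith
    then show ?thesis using False j by (subst bump_eq_0) auto
  qed (simp add: bump_bounds)
  then have "(\<Sum>i<N. bump N i x) \<le> (\<Sum>i<N. if i = j then 1 else 0)" by (intro sum_mono)
  also have "\<dots> \<le> 1" by simp
  finally show ?thesis .
qed

text \<open>Added to \<open>f\<close>, it yields the convex combination of \<open>f\<close> and
  \<open>r\<close> with weight \<open>bump\<close>: \<open>r\<close> on the plateau,
  \<open>f\<close> off the support.\<close>

definition perturbation :: "nat \<Rightarrow> nat \<Rightarrow> C01 \<Rightarrow> C01 \<Rightarrow> C01" where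
  "perturbation N i f r = Bcontfun (\<lambda>x. bump N i (Rep_unit_interval x) * (r x - f x))"

lemma apply_perturbation:
  "perturbation N i f r x = bump N i (Rep_unit_interval x) * (r x - f x)"
  unfolding perturbation_def
  by (subst apply_Bcontfun_unit_interval) (auto intro!: continuous_intros)

lemma norm_add_perturbation_le:
  assumes "norm f \<le> 1" "norm r \<le> 1"
  shows "norm (f + perturbation N i f r) \<le> 1"
proof (rule norm_bound)
  fix x
  let ?b = "bump N i (Rep_unit_interval x)"
  have le: "\<bar>f x\<bar> \<le> 1" "\<bar>r x\<bar> \<le> 1"
    using abs_apply_le_norm[of f x] abs_apply_le_norm[of r x] assms by linarith+
  have "(f + perturbation N i f r) x = (1 - ?b) * f x + ?b * r x"
    by (simp add: apply_perturbation algebra_simps)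
  also have "\<bar>\<dots>\<bar> \<le> (1 - ?b) * \<bar>f x\<bar> + ?b * \<bar>r x\<bar>"
    using bump_bounds[of N i] by (intro order.trans[OF abs_triangle_ineq]) (simp add: abs_mult)
  also have "\<dots> \<le> (1 - ?b) * 1 + ?b * 1"
    using bump_bounds[of N i] le by (intro add_mono mult_left_mono) auto
  finally show "norm ((f + perturbation N i f r) x) \<le> 1" by simp
qed

text \<open>The perturbations on the intervals \<open>(i/N, (i+1)/N)\<close> have disjoint supports, so every signed
  sum of them has norm at most 2; hence \<open>\<Phi>\<close> cannot be large on each of \<open>N > 2 / \<eta>\<close> of them.\<close>

lemma exists_insensitive_interval:
  fixes \<Phi> :: "C01 \<Rightarrow> real"
  assumes lin: "linear \<Phi>" and bound: "\<And>h. \<bar>\<Phi> h\<bar> \<le> norm h"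
    and f: "norm f \<le> 1" and \<eta>: "\<eta> > 0"
  obtains N i where "i < N" "\<And>r. norm r \<le> 1 \<Longrightarrow> \<bar>\<Phi> (perturbation N i f r)\<bar> \<le> \<eta>"
proof (rule ccontr)
  assume contra: "\<not> thesis"
  note insensitive = that
  obtain N :: nat where N: "2 / \<eta> < real N" using reals_Archimedean2 by blast
  have "\<exists>r. norm r \<le> 1 \<and> \<bar>\<Phi> (perturbation N i f r)\<bar> > \<eta>" if "i < N" for i
    using contra insensitive[OF that] not_le by blast
  then obtain r where r: "\<And>i. i < N \<Longrightarrow> norm (r i) \<le> 1"
    "\<And>i. i < N \<Longrightarrow> \<bar>\<Phi> (perturbation N i f (r i))\<bar> > \<eta>" by metis
  \<comment> \<open>The signs make \<open>\<Phi> F\<close> the sum of the moduli, which is at least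
    \<open>N * \<eta>\<close> and hence exceeds 2.\<close>
  define F where "F = (\<Sum>i<N. sgn (\<Phi> (perturbation N i f (r i))) *\<^sub>R perturbation N i f (r i))"
  have "norm F \<le> 2"
  proof (rule norm_bound)
    fix x
    have term_le: "\<bar>sgn (\<Phi> (perturbation N i f (r i))) * perturbation N i f (r i) x\<bar>
        \<le> 2 * bump N i (Rep_unit_interval x)" if i: "i < N" for i
    proof -
      have "\<bar>r i x - f x\<bar> \<le> 2"
        using abs_apply_le_norm[of f x] abs_apply_le_norm[of "r i" x] f r(1)[OF i] by linarith
      then have "bump N i (Rep_unit_interval x) * \<bar>r i x - f x\<bar> \<le> bump N i (Rep_unit_interval x) * 2"
        by (intro mult_left_mono bump_bounds)
      moreover have "\<bar>sgn (\<Phi> (perturbation N i f (r i)))\<bar> = 1"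
        using r(2)[OF i] \<eta> by (auto simp: abs_sgn_eq)
      ultimately show ?thesis
        using bump_bounds(1)[of N i] by (simp add: apply_perturbation abs_mult mult.commute)
    qed
    have "\<bar>F x\<bar> \<le> (\<Sum>i<N. \<bar>sgn (\<Phi> (perturbation N i f (r i))) * perturbation N i f (r i) x\<bar>)"
      unfolding F_def by (simp add: apply_bcontfun_sum)
    also have "\<dots> \<le> (\<Sum>i<N. 2 * bump N i (Rep_unit_interval x))"
      by (intro sum_mono term_le) simp
    also have "\<dots> = 2 * (\<Sum>i<N. bump N i (Rep_unit_interval x))" by (rule sum_distrib_left[symmetric])
    also have "\<dots> \<le> 2 * 1"
      using Rep_unit_interval[of x] by (intro mult_left_mono sum_bump_le_1) auto
    finally show "norm (F x) \<le> 2" by simp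
  qed
  moreover have "\<Phi> F = (\<Sum>i<N. \<bar>\<Phi> (perturbation N i f (r i))\<bar>)"
    unfolding F_def by (simp add: linear_sum[OF lin] linear_cmul[OF lin] abs_sgn mult.commute)
  moreover have "(\<Sum>i<N. \<bar>\<Phi> (perturbation N i f (r i))\<bar>) \<ge> (\<Sum>i<N. \<eta>)"
    using r(2) by (intro sum_mono) (auto intro: less_imp_le)
  ultimately have "real N * \<eta> \<le> 2" using bound[of F] by simp
  then show False using N \<eta> by (simp add: field_simps)
qed

text \<open>This is the argument on \<open>C01\<close> itself: \<open>close\<close> is what a slice
  of diameter below \<open>d\<close> in the quotient says about representatives. The resulting lower
  bound for the copy of \<open>l1\<close> is \<open>2 - d\<close>.\<close>

lemma contains_l1_of_close_slice:
  fixes \<Phi> :: "C01 \<Rightarrow> real" and Z :: "C01 set"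
  assumes Z: "subspace Z" "closed Z"
    and lin: "linear \<Phi>" and bound: "\<And>h. \<bar>\<Phi> h\<bar> \<le> norm h"
    and f: "norm f \<le> 1" "\<Phi> f > a" and d: "d < 2"
    and close: "\<And>g h. norm g \<le> 1 \<Longrightarrow> norm h \<le> 1 \<Longrightarrow> \<Phi> g > a \<Longrightarrow> \<Phi> h > a
      \<Longrightarrow> \<exists>z\<in>Z. norm (g - h - z) < d"
  shows "contains_l1 Z"
proof -
  \<comment> \<open>Half the margin: a change of \<open>\<Phi> f\<close> by at most
    \<open>\<eta>\<close> keeps it above \<open>a\<close>.\<close>
  define \<eta> where "\<eta> = (\<Phi> f - a) / 2"
  have \<eta>: "\<eta> > 0" using f by (simp add: \<eta>_def)
  obtain N i where i: "i < N"
    and small: "\<And>r. norm r \<le> 1 \<Longrightarrow> \<bar>\<Phi> (perturbation N i f r)\<bar> \<le> \<eta>"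
    using exists_insensitive_interval[OF lin bound f(1) \<eta>] by blast
  \<comment> \<open>The affine map carries the middle half of interval \<open>i\<close>, where the
    bump is 1, onto the interval from 0 to 1 used in \<open>clamped_cos_independent\<close>.\<close>
  define r :: "nat \<Rightarrow> C01" where
    "r n = Bcontfun (\<lambda>x. clamped_cos n (2 * (real N * Rep_unit_interval x - real i) - 1/2))" for n
  have r_apply: "r n x = clamped_cos n (2 * (real N * Rep_unit_interval x - real i) - 1/2)" for n x
    unfolding r_def by (subst apply_Bcontfun_unit_interval) (auto intro!: continuous_intros)
  have r: "norm (r n) \<le> 1" for n
    by (rule norm_bound) (simp add: r_apply abs_clamped_cos_le_1)
  define pert where "pert s = f + perturbation N i f s" for s
  have pert_norm: "norm (pert s) \<le> 1" if "norm s \<le> 1" for s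
    unfolding pert_def using f(1) that by (rule norm_add_perturbation_le)
  have pert_slice: "\<Phi> (pert s) > a" if "norm s \<le> 1" for s
    using small[OF that] f(2) by (simp add: pert_def linear_add[OF lin] \<eta>_def field_simps abs_le_iff)
  have "\<exists>z\<in>Z. norm (pert (r n) - pert (- r n) - z) < d" for n
    using r[of n] by (intro close pert_norm pert_slice) auto
  then obtain z where z: "\<And>n. z n \<in> Z" "\<And>n. norm (pert (r n) - pert (- r n) - z n) < d"
    by metis
  show ?thesis
  proof (rule contains_l1_of_signs[OF Z z(1)])
    fix n
    have "norm (z n) \<le> norm (pert (r n) - pert (- r n)) + norm (pert (r n) - pert (- r n) - z n)"
      using norm_triangle_ineq4[of "pert (r n) - pert (- r n)" "pert (r n) - pert (- r n) - z n"] by simp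
    also have "\<dots> \<le> (norm (pert (r n)) + norm (pert (- r n))) + d"
      using z(2)[of n] by (intro add_mono norm_triangle_ineq4) simp
    also have "\<dots> \<le> (1 + 1) + 2" using r[of n] d by (intro add_mono pert_norm) auto
    finally show "norm (z n) \<le> 4" by simp
  next
    fix s :: "nat \<Rightarrow> bool"
    obtain x where x: "0 \<le> x" "x \<le> 1" "\<And>n. clamped_cos n x = (if s n then 1 else -1)"
      using clamped_cos_independent by blast
    \<comment> \<open>The preimage of \<open>x\<close> under the affine map in \<open>r\<close>, in
      the coordinate of interval \<open>i\<close>.\<close>
    define u where "u = (x + 1/2) / 2"
    define t where "t = Abs_unit_interval ((real i + u) / real N)"
    have u: "1/4 \<le> u" "u \<le> 3/4" using x by (auto simp: u_def)
    have "real i + 1 \<le> real N" using i by linarith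
    then have "(real i + u) / real N \<in> {0..1}" using u i by (auto simp: field_simps)
    then have t: "real N * Rep_unit_interval t = real i + u"
      using i by (simp add: t_def Abs_unit_interval_inverse)
    have bump: "bump N i (Rep_unit_interval t) = 1" using u by (intro bump_eq_1) (auto simp: t)
    have "2 * (real N * Rep_unit_interval t - real i) - 1/2 = x"
      unfolding t by (simp add: u_def field_simps)
    then have r_val: "r n t = (if s n then 1 else -1)" for n
      using x(3)[of n] by (simp only: r_apply)
    \<comment> \<open>With bump value 1, \<open>f\<close> drops out of both functions, leaving
      \<open>r n\<close> and \<open>- r n\<close>.\<close>
    have val: "(pert (r n) - pert (- r n)) t = 2 * (if s n then 1 else -1)" for n
      by (simp add: pert_def apply_perturbation bump r_val)
    have "(if s n then 1 else -1) * z n t \<ge> 2 - d" for n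
    proof -
      have "\<bar>(pert (r n) - pert (- r n) - z n) t\<bar> < d"
        using abs_apply_le_norm[of "pert (r n) - pert (- r n) - z n" t] z(2)[of n] by linarith
      then show ?thesis using val[of n] by (auto split: if_splits)
    qed
    then show "\<exists>t. \<forall>n. (if s n then 1 else -1) * z n t \<ge> 2 - d" by blast
  qed (use d in simp)
qed

section \<open>The quotient norm\<close>

lemma nlinear_coset:
  fixes Z :: "'a::real_normed_vector set"
  assumes "subspace Z"
  shows "nlinear (subspace_nspace UNIV) (quotient_nspace Z) (\<lambda>f. (+) f ` Z)"
proof -
  have "(+) (f + g) ` Z = {a + b |a b. a \<in> (+) f ` Z \<and> b \<in> (+) g ` Z}" for f g
  proof safe
    fix z assume "z \<in> Z"
    then show "\<exists>a b. f + g + z = a + b \<and> a \<in> (+) f ` Z \<and> b \<in> (+) g ` Z"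
      using subspace_0[OF assms]
      by (intro exI[of _ "f + z"] exI[of _ "g + 0"]) (auto simp: algebra_simps)
  next
    fix y z assume "y \<in> Z" "z \<in> Z"
    then show "f + y + (g + z) \<in> (+) (f + g) ` Z"
      by (intro image_eqI[of _ _ "y + z"]) (auto simp: algebra_simps subspace_add[OF assms])
  qed
  moreover have "(+) (c *\<^sub>R f) ` Z = {c *\<^sub>R a + z |a z. a \<in> (+) f ` Z \<and> z \<in> Z}" for c f
  proof safe
    fix z assume "z \<in> Z"
    then show "\<exists>a z'. c *\<^sub>R f + z = c *\<^sub>R a + z' \<and> a \<in> (+) f ` Z \<and> z' \<in> Z"
      using subspace_0[OF assms] by (intro exI[of _ "f + 0"] exI[of _ z]) auto
  next
    fix y z assume "y \<in> Z" "z \<in> Z"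
    then show "c *\<^sub>R (f + y) + z \<in> (+) (c *\<^sub>R f) ` Z"
      by (intro image_eqI[of _ _ "c *\<^sub>R y + z"])
         (auto simp: algebra_simps subspace_add[OF assms] subspace_scale[OF assms])
  qed
  ultimately show ?thesis
    by (simp add: nlinear_def subspace_nspace_def quotient_nspace_def)
qed

lemma nnorm_coset_le:
  fixes Z :: "'a::real_normed_vector set"
  assumes "subspace Z"
  shows "nnorm (quotient_nspace Z) ((+) f ` Z) \<le> norm f"
proof -
  have "f \<in> (+) f ` Z" using subspace_0[OF assms] by force
  moreover have "bdd_below (norm ` ((+) f ` Z))" by (intro bdd_belowI[of _ 0]) auto
  ultimately show ?thesis by (simp add: quotient_nspace_def cINF_lower)
qed

text \<open>The infimum defining the quotient norm need not be attained, so only a strict bound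
  passes to a representative.\<close>

lemma nnorm_coset_lessD:
  fixes Z :: "'a::real_normed_vector set"
  assumes "subspace Z" "nnorm (quotient_nspace Z) ((+) f ` Z) < c"
  obtains z where "z \<in> Z" "norm (f - z) < c"
proof -
  have "(+) f ` Z \<noteq> {}" using subspace_0[OF assms(1)] by blast
  then obtain a where "a \<in> (+) f ` Z" "norm a < c"
    using assms(2) cInf_lessD[of "norm ` ((+) f ` Z)" c] by (auto simp: quotient_nspace_def)
  then obtain y where "y \<in> Z" "norm (f + y) < c" by blast
  then show thesis using that[of "- y"] subspace_neg[OF assms(1)] by simp
qed

section \<open>Slices of the unit ball of the quotient\<close>

theorem theorem3p6:
  fixes Z :: "C01 set"
  assumes "subspace Z" and "closed Z"
    and "\<not> contains_l1 Z"
  shows "slice_diameter_two (quotient_nspace Z)"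
  unfolding slice_diameter_two_def
proof (intro ballI allI impI)
  fix \<phi> and \<epsilon> :: real
  let ?X = "quotient_nspace Z"
  let ?q = "\<lambda>f. (+) f ` Z"
  assume \<phi>: "\<phi> \<in> ndual_sphere ?X" and \<epsilon>: "\<epsilon> > 0"
  have X: "normed_space_on ?X" using assms(1,2) by (rule normed_space_on_quotient)
  interpret X: normed_space_on ?X by (rule X)
  have carrier: "ncarrier ?X = range ?q" by (simp add: quotient_nspace_def)
  have q_add: "nadd ?X (?q f) (?q g) = ?q (f + g)"
    and q_scale: "nscale ?X c (?q f) = ?q (c *\<^sub>R f)" for f g c
    using nlinear_coset[OF assms(1)] by (auto simp: nlinear_def subspace_nspace_def)
  have q_Z: "?q (f - z) = ?q f" if "z \<in> Z" for f z
  proof -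
    have "?q (- z) = ?q 0"
      using subspace_0[OF assms(1)] subspace_diff[OF assms(1)] subspace_add[OF assms(1)] that
      by (auto intro!: image_eqI[of _ _ "_ + z"])
    then show ?thesis using q_add[of f "- z"] q_add[of f 0] by simp
  qed
  have q_dist: "ndist ?X (?q f) (?q g) = nnorm ?X (?q (f - g))" for f g
    unfolding ndist_def carrier q_scale q_add by simp
  have q_ball: "?q f \<in> nball ?X" if "norm f \<le> 1" for f
    using nnorm_coset_le[OF assms(1), of f] that by (simp add: nball_def carrier)
  \<comment> \<open>The pullback of \<open>\<phi>\<close> along the quotient map; it is constant on
    cosets of \<open>Z\<close>.\<close>
  define \<Phi> where "\<Phi> f = \<phi> (?q f)" for f
  have dual: "\<phi> \<in> ndual ?X" and sup: "(SUP x\<in>nball ?X. \<bar>\<phi> x\<bar>) = 1"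
    using \<phi> by (auto simp: ndual_sphere_def dual_norm_def)
  have lin: "linear \<Phi>"
  proof (rule linearI)
    fix f g :: C01 and c :: real
    have \<phi>_lin: "nlinear ?X real_nspace \<phi>" using dual by (simp add: ndual_def)
    show "\<Phi> (f + g) = \<Phi> f + \<Phi> g" "\<Phi> (c *\<^sub>R f) = c *\<^sub>R \<Phi> f"
      using \<phi>_lin unfolding \<Phi>_def q_add[symmetric] q_scale[symmetric]
      by (auto simp: nlinear_def subspace_nspace_def carrier)
  qed
  have \<Phi>_ball: "\<bar>\<phi> x\<bar> \<le> 1" if "x \<in> nball ?X" for x
    using cSUP_upper[OF that ndual_bdd_above[OF X dual]] sup by simp
  have bound: "\<bar>\<Phi> h\<bar> \<le> norm h" for h
  proof (cases "h = 0")
    case True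
    then show ?thesis by (simp add: linear_0[OF lin])
  next
    case False
    then have "\<bar>\<Phi> (inverse (norm h) *\<^sub>R h)\<bar> \<le> 1"
      unfolding \<Phi>_def by (intro \<Phi>_ball q_ball) simp
    then show ?thesis
      using False by (simp add: linear_cmul[OF lin] abs_mult field_simps)
  qed
  obtain f where f: "norm f \<le> 1" "\<Phi> f > 1 - \<epsilon>"
  proof -
    \<comment> \<open>The maximum with 0 covers \<open>\<epsilon> > 1\<close> and forces
      \<open>\<phi> x\<close> to be nonzero below.\<close>
    define b where "b = max (1 - \<epsilon>) 0"
    have b: "0 \<le> b" "b < 1" "1 - \<epsilon> \<le> b" using \<epsilon> by (auto simp: b_def)
    have "nball ?X \<noteq> {}" using q_ball[of 0] by auto
    then obtain x where x: "x \<in> nball ?X" "\<bar>\<phi> x\<bar> > b"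
      using less_cSUP_iff[OF _ ndual_bdd_above[OF X dual], of b] sup b by auto
    then obtain f0 where f0: "x = ?q f0" by (auto simp: nball_def carrier)
    \<comment> \<open>A representative of norm below \<open>1 + \<delta>\<close> is divided by
      \<open>1 + \<delta>\<close> to enter the unit ball. Half the margin is small enough for the
      value to stay above \<open>b\<close>, as
      \<open>b * (1 + \<delta>) \<le> b + \<delta>\<close>.\<close>
    define \<delta> where "\<delta> = (\<bar>\<phi> x\<bar> - b) / 2"
    have \<delta>: "\<delta> > 0" using x by (simp add: \<delta>_def)
    have "nnorm ?X (?q f0) < 1 + \<delta>" using x \<delta> f0 by (simp add: nball_def)
    then obtain z where z: "z \<in> Z" "norm (f0 - z) < 1 + \<delta>" by (rule nnorm_coset_lessD[OF assms(1)])
    \<comment> \<open>The sign is needed because the dual norm sees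
      \<open>\<bar>\<phi> x\<bar>\<close>, whereas the slice is defined by \<open>\<phi>\<close>
      itself.\<close>
    define f where "f = (sgn (\<phi> x) / (1 + \<delta>)) *\<^sub>R (f0 - z)"
    have "\<Phi> (f0 - z) = \<phi> x" using z q_Z f0 by (simp add: \<Phi>_def)
    then have "\<Phi> f = \<bar>\<phi> x\<bar> / (1 + \<delta>)"
      unfolding f_def by (simp only: linear_cmul[OF lin]) (simp add: abs_sgn mult.commute)
    moreover have "b * (1 + \<delta>) < \<bar>\<phi> x\<bar>"
    proof -
      have "b * \<delta> \<le> 1 * \<delta>" using b \<delta> by (intro mult_right_mono) auto
      moreover have "\<bar>\<phi> x\<bar> = b + 2 * \<delta>" unfolding \<delta>_def by (simp add: field_simps)
      ultimately show ?thesis using \<delta> unfolding distrib_left by linarith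
    qed
    ultimately have "\<Phi> f > b" using \<delta> by (simp add: pos_less_divide_eq)
    then have "\<Phi> f > 1 - \<epsilon>" using b(3) by linarith
    moreover have "norm f \<le> 1"
      using z \<delta> x b by (simp add: f_def abs_sgn_eq)
    ultimately show thesis using that by blast
  qed
  define S where "S = nslice ?X \<phi> \<epsilon>"
  have q_slice: "?q g \<in> S" if "norm g \<le> 1" "\<Phi> g > 1 - \<epsilon>" for g
    using that q_ball by (simp add: S_def nslice_def \<Phi>_def)
  \<comment> \<open>This excludes the default diameter 0 of the empty set.\<close>
  have S_ne: "S \<times> S \<noteq> {}" using q_slice[OF f] by blast
  have dist_le: "ndist ?X x y \<le> 2" if "x \<in> S" "y \<in> S" for x y
  proof -
    have x: "x \<in> ncarrier ?X" "nnorm ?X x \<le> 1" and y: "y \<in> ncarrier ?X" "nnorm ?X y \<le> 1"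
      using that by (auto simp: S_def nslice_def nball_def)
    have "ndist ?X x y \<le> nnorm ?X x + nnorm ?X (nscale ?X (-1) y)"
      using x y X.norm_triangle X.scale_closed by (simp add: ndist_def)
    also have "\<dots> \<le> 2" using x y by (simp add: X.norm_scale)
    finally show ?thesis .
  qed
  define D where "D = (SUP (x, y)\<in>S \<times> S. ndist ?X x y)"
  have bdd: "bdd_above ((\<lambda>(x, y). ndist ?X x y) ` (S \<times> S))"
    using dist_le by (intro bdd_aboveI[of _ 2]) auto
  have "D \<le> 2" unfolding D_def using dist_le by (intro cSUP_least S_ne) auto
  moreover have "\<not> D < 2"
  proof
    assume D: "D < 2"
    have "contains_l1 Z"
    \<comment> \<open>The midpoint of \<open>D\<close> and 2 gives the strict bound that a
      representative requires, still below 2.\<close>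
    proof (rule contains_l1_of_close_slice[OF assms(1,2) lin bound f, of "(D + 2) / 2"])
      fix g h assume gh: "norm g \<le> 1" "norm h \<le> 1" "\<Phi> g > 1 - \<epsilon>" "\<Phi> h > 1 - \<epsilon>"
      have "ndist ?X (?q g) (?q h) \<le> D"
        using cSUP_upper[OF _ bdd, of "(?q g, ?q h)"] q_slice gh by (simp add: D_def)
      then have "nnorm ?X (?q (g - h)) < (D + 2) / 2" using D by (simp add: q_dist)
      then show "\<exists>z\<in>Z. norm (g - h - z) < (D + 2) / 2"
        by (meson nnorm_coset_lessD[OF assms(1)])
    qed (use D in simp)
    then show False using assms(3) by simp
  qed
  ultimately show "ndiameter ?X (nslice ?X \<phi> \<epsilon>) = 2"
    using S_ne by (auto simp: ndiameter_def S_def D_def)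
qed

end
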